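(* Let $D$ be a database and $\lambda\ge 0$. Suppose that for all $T\subseteq[d]$ with $|T|\le k$ we have estimates $\hat y_T$ satisfying $|\hat y_T-\mathrm{parity}_T(D)|\le\lambda$. Then one can efficiently construct (from the estimates $\hat y_T$ alone) estimates $z_{S,\beta}$ for all $S\subseteq[d]$ with $|S|=k$ and all $\beta\in\{-1,1\}^S$ such that $|z_{S,\beta}-\mathrm{marg}_{(S,\beta)}(D)|\le\lambda$.
   Context: A database $D$ is a multiset of elements of $\{-1,1\}^d$. For $S\subseteq[d]$, the parity query is $\mathrm{parity}_S(D)=\sum_{e\in D}\prod_{i\in S}e_i$ (so $\mathrm{parity}_\emptyset(D)=|D|$). For $|S|=k$ and $\beta\in\{-1,1\}^S$, the $k$-way marginal query is $\mathrm{marg}_{(S,\beta)}(D)=\sum_{e\in D}\prod_{i\in S}\mathbf{1}(e_i=\beta_i)$. *)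

theory Defs
  imports
    "HOL-Library.Multiset"
    "HOL-Library.FuncSet"
    "HOL-Computational_Algebra.Polynomial"
begin

definition database :: "nat \<Rightarrow> (nat \<Rightarrow> int) multiset \<Rightarrow> bool" where
  "database d D \<longleftrightarrow> set_mset D \<subseteq> {1..d} \<rightarrow>\<^sub>E {-1, 1}"

definition parity :: "nat set \<Rightarrow> (nat \<Rightarrow> int) multiset \<Rightarrow> int" where
  "parity S D = (\<Sum>e\<in>#D. \<Prod>i\<in>S. e i)"

definition marg :: "nat set \<Rightarrow> (nat \<Rightarrow> int) \<Rightarrow> (nat \<Rightarrow> int) multiset \<Rightarrow> int" where
  "marg S \<beta> D = (\<Sum>e\<in>#D. \<Prod>i\<in>S. of_bool (e i = \<beta> i))"

definition low_sets :: "nat \<Rightarrow> nat \<Rightarrow> nat set set" where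
  "low_sets d k = {T. T \<subseteq> {1..d} \<and> card T \<le> k}"

definition marg_queries :: "nat \<Rightarrow> nat \<Rightarrow> (nat set \<times> (nat \<Rightarrow> int)) set" where
  "marg_queries d k = {(S, \<beta>). S \<subseteq> {1..d} \<and> card S = k \<and> \<beta> \<in> S \<rightarrow>\<^sub>E {-1, 1}}"

text \<open>
  Efficiency is measured in the WHILE language over binary trees (N. D. Jones,
  \<^emph>\<open>Computability and Complexity from a Programming Perspective\<close>), whose
  polynomial-time programs decide exactly the problems in P. As in the real-RAM model,
  leaves may additionally carry real numbers, on which the field operations and
  comparison are exact and take unit time; only integer constants are available.
\<close>

datatype data = DNil | DReal real | DPair data data

type_synonym vname = string
type_synonym state = "vname \<Rightarrow> data"

datatype expr =
    Var vname
  | NilE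
  | ConstE int
  | PairE expr expr
  | HdE expr
  | TlE expr
  | AddE expr expr
  | SubE expr expr
  | MulE expr expr
  | DivE expr expr
  | LessE expr expr

fun fst_of :: "data \<Rightarrow> data" where
  "fst_of (DPair a b) = a"
| "fst_of _ = DNil"

fun snd_of :: "data \<Rightarrow> data" where
  "snd_of (DPair a b) = b"
| "snd_of _ = DNil"

fun arith :: "(real \<Rightarrow> real \<Rightarrow> real) \<Rightarrow> data \<Rightarrow> data \<Rightarrow> data" where
  "arith f (DReal a) (DReal b) = DReal (f a b)"
| "arith f _ _ = DNil"

definition enc_bool :: "bool \<Rightarrow> data" where
  "enc_bool b = (if b then DPair DNil DNil else DNil)"

fun less_of :: "data \<Rightarrow> data \<Rightarrow> data" where
  "less_of (DReal a) (DReal b) = enc_bool (a < b)"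
| "less_of _ _ = DNil"

fun eval :: "expr \<Rightarrow> state \<Rightarrow> data" where
  "eval (Var x) s = s x"
| "eval NilE s = DNil"
| "eval (ConstE n) s = DReal (of_int n)"
| "eval (PairE a b) s = DPair (eval a s) (eval b s)"
| "eval (HdE a) s = fst_of (eval a s)"
| "eval (TlE a) s = snd_of (eval a s)"
| "eval (AddE a b) s = arith (+) (eval a s) (eval b s)"
| "eval (SubE a b) s = arith (-) (eval a s) (eval b s)"
| "eval (MulE a b) s = arith (*) (eval a s) (eval b s)"
| "eval (DivE a b) s = arith (/) (eval a s) (eval b s)"
| "eval (LessE a b) s = less_of (eval a s) (eval b s)"

fun cost :: "expr \<Rightarrow> nat" where
  "cost (Var x) = 1"
| "cost NilE = 1"
| "cost (ConstE n) = 1"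
| "cost (PairE a b) = 1 + cost a + cost b"
| "cost (HdE a) = 1 + cost a"
| "cost (TlE a) = 1 + cost a"
| "cost (AddE a b) = 1 + cost a + cost b"
| "cost (SubE a b) = 1 + cost a + cost b"
| "cost (MulE a b) = 1 + cost a + cost b"
| "cost (DivE a b) = 1 + cost a + cost b"
| "cost (LessE a b) = 1 + cost a + cost b"

datatype com =
    Skip
  | Assign vname expr
  | Seq com com
  | Cond expr com com
  | While expr com

text \<open>\<open>exec c s t s'\<close>: started in \<open>s\<close>, \<open>c\<close> terminates in \<open>s'\<close> after
  exactly \<open>t\<close> steps. As a condition, \<open>DNil\<close> is false and everything else is true.\<close>

inductive exec :: "com \<Rightarrow> state \<Rightarrow> nat \<Rightarrow> state \<Rightarrow> bool" where
  Skip: "exec Skip s 1 s"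
| Assign: "exec (Assign x a) s (1 + cost a) (s(x := eval a s))"
| Seq: "exec c1 s t1 s1 \<Longrightarrow> exec c2 s1 t2 s2 \<Longrightarrow> exec (Seq c1 c2) s (t1 + t2) s2"
| CondTrue: "eval b s \<noteq> DNil \<Longrightarrow> exec c1 s t s' \<Longrightarrow> exec (Cond b c1 c2) s (1 + cost b + t) s'"
| CondFalse: "eval b s = DNil \<Longrightarrow> exec c2 s t s' \<Longrightarrow> exec (Cond b c1 c2) s (1 + cost b + t) s'"
| WhileFalse: "eval b s = DNil \<Longrightarrow> exec (While b c) s (1 + cost b) s"
| WhileTrue: "eval b s \<noteq> DNil \<Longrightarrow> exec c s t1 s1 \<Longrightarrow> exec (While b c) s1 t2 s2 \<Longrightarrow>
    exec (While b c) s (1 + cost b + t1 + t2) s2"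

inductive_cases SkipE [elim!]: "exec Skip s t s'"
inductive_cases AssignE [elim!]: "exec (Assign x a) s t s'"
inductive_cases SeqE [elim!]: "exec (Seq c1 c2) s t s'"
inductive_cases CondE [elim!]: "exec (Cond b c1 c2) s t s'"
inductive_cases WhileE: "exec (While b c) s t s'"

lemma exec_deterministic:
  "exec c s t s' \<Longrightarrow> exec c s u s'' \<Longrightarrow> u = t \<and> s'' = s'"
proof (induction arbitrary: u s'' rule: exec.induct)
  case (WhileFalse b s c)
  from WhileFalse.prems show ?case
    by (rule WhileE) (use WhileFalse.hyps in simp_all)
next
  case (WhileTrue b s c t1 s1 t2 s2)
  obtain v1 r v2 where "exec c s v1 r" "exec (While b c) r v2 s''" "u = 1 + cost b + v1 + v2"
    by (rule WhileE [OF WhileTrue.prems]) (use WhileTrue.hyps(1) in simp_all)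
  with WhileTrue.IH show ?case by metis
qed (fastforce+)

definition computes_in :: "com \<Rightarrow> data \<Rightarrow> nat \<Rightarrow> data \<Rightarrow> bool" where
  "computes_in c x t y \<longleftrightarrow>
     (\<exists>s. exec c ((\<lambda>_. DNil)(''in'' := x)) t s \<and> s ''out'' = y)"

fun dsize :: "data \<Rightarrow> nat" where
  "dsize DNil = 1"
| "dsize (DReal r) = 1"
| "dsize (DPair a b) = 1 + dsize a + dsize b"

fun enc_list :: "data list \<Rightarrow> data" where
  "enc_list [] = DNil"
| "enc_list (x # xs) = DPair x (enc_list xs)"

definition enc_nat :: "nat \<Rightarrow> data" where
  "enc_nat n = enc_list (replicate n DNil)"

definition enc_set :: "nat \<Rightarrow> nat set \<Rightarrow> data" where
  "enc_set d T = enc_list (map (\<lambda>i. enc_bool (i \<in> T)) [1..<Suc d])"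

text \<open>A sign pattern on \<open>S\<close> is written as a vector of length \<open>d\<close>, padded with 0 outside \<open>S\<close>.\<close>

definition enc_signs :: "nat \<Rightarrow> nat set \<Rightarrow> (nat \<Rightarrow> int) \<Rightarrow> data" where
  "enc_signs d S \<beta> =
     enc_list (map (\<lambda>i. DReal (if i \<in> S then of_int (\<beta> i) else 0)) [1..<Suc d])"

definition enc_estimates :: "nat \<Rightarrow> nat \<Rightarrow> (nat set \<Rightarrow> real) \<Rightarrow> nat set list \<Rightarrow> data" where
  "enc_estimates d k y Ts =
     DPair (enc_nat d) (DPair (enc_nat k)
       (enc_list (map (\<lambda>T. DPair (enc_set d T) (DReal (y T))) Ts)))"

definition enc_marginals ::
    "nat \<Rightarrow> (nat set \<Rightarrow> (nat \<Rightarrow> int) \<Rightarrow> real) \<Rightarrow> (nat set \<times> (nat \<Rightarrow> int)) list \<Rightarrow> data" where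
  "enc_marginals d z Qs =
     enc_list (map (\<lambda>(S, \<beta>). DPair (enc_set d S) (DPair (enc_signs d S \<beta>) (DReal (z S \<beta>)))) Qs)"

text \<open>
  In polynomial time the program \<open>c\<close> turns the table of \<open>y T\<close> for all \<open>T\<close> in
  \<open>low_sets d k\<close>, listed in any order \<open>Ts\<close>, into a table of
  \<open>z S \<beta>\<close> for all \<open>(S, \<beta>)\<close> in \<open>marg_queries d k\<close>. The same \<open>c\<close> and \<open>p\<close> serve
  all \<open>d\<close> and \<open>k\<close>.
\<close>

definition constructs_within ::
    "com \<Rightarrow> nat poly \<Rightarrow> nat \<Rightarrow> nat \<Rightarrow> (nat set \<Rightarrow> real) \<Rightarrow>
     (nat set \<Rightarrow> (nat \<Rightarrow> int) \<Rightarrow> real) \<Rightarrow> bool" where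
  "constructs_within c p d k y z \<longleftrightarrow>
     (\<forall>Ts. distinct Ts \<and> set Ts = low_sets d k \<longrightarrow>
       (\<exists>t Qs. distinct Qs \<and> set Qs = marg_queries d k \<and>
          t \<le> poly p (dsize (enc_estimates d k y Ts)) \<and>
          computes_in c (enc_estimates d k y Ts) t (enc_marginals d z Qs)))"

end

theory Submission imports Defs begin

text \<open>
  For signs \<open>e i\<close> and \<open>\<beta> i\<close> the indicator of \<open>e i = \<beta> i\<close> is \<open>(1 + e i * \<beta> i) / 2\<close>.
  Expanding the product over \<open>S\<close> writes the marginal as \<open>2 ^ -k\<close> times a sum, over the
  \<open>2 ^ k\<close> subsets \<open>T\<close> of \<open>S\<close>, of parities with coefficients \<open>\<plusminus>1\<close>; substituting the
  estimates for the parities therefore gives an error of at most \<open>\<lambda>\<close>.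

  A sign pattern on \<open>S\<close> is determined by the subset \<open>U\<close> of \<open>S\<close> on which it is
  negative, and both \<open>S\<close> and \<open>U\<close> occur in the input table. So three nested passes over
  that table compute everything: over \<open>S\<close> with \<open>k\<close> elements, over \<open>U \<subseteq> S\<close>, and over
  the \<open>T\<close> being summed. Padding the signs with 0 outside \<open>S\<close> makes the terms with
  \<open>T\<close> not contained in \<open>S\<close> vanish by themselves.
\<close>

section \<open>Weakest preconditions with running time\<close>

text \<open>As \<open>exec\<close> is deterministic, existence of one such run is total correctness;
  the step count is handed to \<open>Q\<close>.\<close>

definition wp :: "com \<Rightarrow> (nat \<Rightarrow> state \<Rightarrow> bool) \<Rightarrow> state \<Rightarrow> bool" where
  "wp c Q s \<longleftrightarrow> (\<exists>t s'. exec c s t s' \<and> Q t s')"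

lemma wp_mono: "wp c Q s \<Longrightarrow> (\<And>t s'. Q t s' \<Longrightarrow> R t s') \<Longrightarrow> wp c R s"
  unfolding wp_def by blast

lemma wp_Skip [simp]: "wp Skip Q = Q 1"
  unfolding wp_def by (intro ext) (metis SkipE exec.Skip)

lemma wp_Assign [simp]: "wp (Assign x a) Q = (\<lambda>s. Q (1 + cost a) (s(x := eval a s)))"
  unfolding wp_def by (intro ext) (metis AssignE exec.Assign)

lemma wp_Seq [simp]: "wp (Seq c1 c2) Q = wp c1 (\<lambda>t. wp c2 (\<lambda>u. Q (t + u)))"
  unfolding wp_def by (intro ext) (blast intro: exec.Seq)

lemma exec_Cond_iff:
  "exec (Cond b c1 c2) s u s' \<longleftrightarrow>
     (\<exists>t. u = 1 + cost b + t \<and> exec (if eval b s = DNil then c2 else c1) s t s')"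
  by (auto simp del: One_nat_def add_Suc intro: exec.CondTrue exec.CondFalse)

lemma wp_Cond [simp]:
  "wp (Cond b c1 c2) Q =
     (\<lambda>s. wp (if eval b s = DNil then c2 else c1) (\<lambda>t. Q (1 + cost b + t)) s)"
  unfolding wp_def exec_Cond_iff by (intro ext) auto

lemma wp_WhileFalse: "eval b s = DNil \<Longrightarrow> Q (1 + cost b) s \<Longrightarrow> wp (While b c) Q s"
  unfolding wp_def by (blast intro: exec.WhileFalse)

lemma wp_WhileTrue:
  assumes "eval b s \<noteq> DNil" "wp c (\<lambda>t. wp (While b c) (\<lambda>u. Q (1 + cost b + t + u))) s"
  shows "wp (While b c) Q s"
  using assms unfolding wp_def by (blast intro: exec.WhileTrue)

definition foreach :: "vname \<Rightarrow> vname \<Rightarrow> com \<Rightarrow> com" where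
  "foreach v l c =
     While (Var l) (Seq (Assign v (HdE (Var l))) (Seq (Assign l (TlE (Var l))) c))"

text \<open>In \<open>I ys zs s\<close> the list \<open>ys\<close> has been processed and
  \<open>zs\<close> remains. \<open>B\<close> bounds one run of the body; \<open>M\<close> stands in
  for the length, so that all bounds become polynomials in \<open>M\<close>.\<close>

lemma wp_foreach:
  assumes "s l = enc_list (map f xs)" and "I [] xs s" and "v \<noteq> l" and "length xs \<le> M"
    and step: "\<And>ys x zs s. xs = ys @ x # zs \<Longrightarrow> I ys (x # zs) s \<Longrightarrow>
      wp c (\<lambda>t s'. t \<le> B \<and> I (ys @ [x]) zs s' \<and> s' l = enc_list (map f zs))
        (s(v := f x, l := enc_list (map f zs)))"
    and fin: "\<And>t s'. t \<le> 2 + M * (B + 8) \<Longrightarrow> I xs [] s' \<Longrightarrow> Q t s'"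
  shows "wp (foreach v l c) Q s"
proof -
  \<comment> \<open>Generalised to an arbitrary split of \<open>xs\<close>, for induction on the
    remainder.\<close>
  have "wp (foreach v l c) (\<lambda>t s'. t \<le> 2 + length zs * (B + 8) \<and> I xs [] s') s"
    if "xs = ys @ zs" "I ys zs s" "s l = enc_list (map f zs)" for ys zs s
    using that
  proof (induction zs arbitrary: ys s)
    case Nil
    then show ?case unfolding foreach_def by (intro wp_WhileFalse) auto
  next
    case (Cons x zs)
    have "wp c (\<lambda>t s'. t \<le> B \<and> I (ys @ [x]) zs s' \<and> s' l = enc_list (map f zs))
        (s(v := f x, l := enc_list (map f zs)))"
      using Cons.prems by (intro step)
    \<comment> \<open>The 8 is 2 for the loop test and 3 for each of the two assignments before the
      body.\<close>
    then have "wp c (\<lambda>t. wp (foreach v l c) (\<lambda>u s'. 8 + t + u \<le> 2 + length (x # zs) * (B + 8)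
        \<and> I xs [] s')) (s(v := f x, l := enc_list (map f zs)))"
    proof (rule wp_mono)
      fix t s' assume *: "t \<le> B \<and> I (ys @ [x]) zs s' \<and> s' l = enc_list (map f zs)"
      then have "wp (foreach v l c) (\<lambda>t s'. t \<le> 2 + length zs * (B + 8) \<and> I xs [] s') s'"
        using Cons.prems by (intro Cons.IH[of "ys @ [x]"]) auto
      then show "wp (foreach v l c) (\<lambda>u s'. 8 + t + u \<le> 2 + length (x # zs) * (B + 8)
          \<and> I xs [] s') s'"
        by (rule wp_mono) (use * in auto)
    qed
    then show ?case
      using Cons.prems \<open>v \<noteq> l\<close> unfolding foreach_def
      by (intro wp_WhileTrue) (simp_all add: fun_upd_twist)
  qed
  from this[of "[]" xs s] assms(1,2)
  have "wp (foreach v l c) (\<lambda>t s'. t \<le> 2 + length xs * (B + 8) \<and> I xs [] s') s" by simp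
  then show ?thesis
  proof (rule wp_mono)
    fix t s' assume "t \<le> 2 + length xs * (B + 8) \<and> I xs [] s'"
    moreover have "length xs * (B + 8) \<le> M * (B + 8)" using assms(4) by (rule mult_le_mono1)
    ultimately show "Q t s'" by (intro fin) linarith+
  qed
qed

section \<open>The program\<close>

definition agree_off :: "vname set \<Rightarrow> state \<Rightarrow> state \<Rightarrow> bool" where
  "agree_off V s s' \<longleftrightarrow> (\<forall>x. x \<notin> V \<longrightarrow> s' x = s x)"

lemma enc_bool_eq_DNil [simp]: "enc_bool b = DNil \<longleftrightarrow> \<not> b"
  by (simp add: enc_bool_def)

section \<open>Weighted sum over the table\<close>

definition weigh :: com where
  "weigh = Seq (Assign ''m'' (HdE (Var ''c''))) (Seq (Assign ''n'' (Var ''g''))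
     (Seq (Assign ''w'' (ConstE 1))
       (foreach ''x'' ''m''
         (Seq (Cond (Var ''x'') (Assign ''w'' (MulE (Var ''w'') (HdE (Var ''n'')))) Skip)
           (Assign ''n'' (TlE (Var ''n'')))))))"

text \<open>The membership vector of \<open>T\<close> and the vector \<open>''g''\<close> are walked
  in lockstep. With padded signs in \<open>''g''\<close> the product is the coefficient of
  \<open>y T\<close>.\<close>

lemma wp_weigh:
  assumes "T \<subseteq> {1..d}" "d \<le> M"
    and "s ''c'' = DPair (enc_set d T) r"
    and "s ''g'' = enc_list (map (\<lambda>i. DReal (b i)) [1..<Suc d])"
    and "\<And>t s'. t \<le> 20 + M * 20 \<Longrightarrow> agree_off {''m'', ''n'', ''w'', ''x''} s s' \<Longrightarrow>
      s' ''w'' = DReal (\<Prod>i\<in>T. b i) \<Longrightarrow> Q t s'"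
  shows "wp weigh Q s"
  unfolding weigh_def wp_Seq wp_Assign
proof (rule wp_foreach[where f = "\<lambda>i. enc_bool (i \<in> T)" and xs = "[1..<Suc d]" and M = M and B = 12
      and I = "\<lambda>ys zs s'. agree_off {''m'', ''n'', ''w'', ''x''} s s' \<and>
        s' ''n'' = enc_list (map (\<lambda>i. DReal (b i)) zs) \<and>
        s' ''w'' = DReal (\<Prod>i\<in>T \<inter> set ys. b i)"], goal_cases)
  case (5 ys x zs s')
  \<comment> \<open>\<open>x\<close> is new, so its factor enters the product only once.\<close>
  have "distinct (ys @ x # zs)" unfolding 5(1)[symmetric] by simp
  then show ?case using 5
    by (auto simp: agree_off_def)
next
  case (6 t s')
  have "T \<inter> set [1..<Suc d] = T" using assms(1) by auto
  then show ?case using 6 by (intro assms(5)) auto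
qed (use assms in \<open>auto simp: agree_off_def enc_set_def\<close>)

definition weighted_sum :: com where
  "weighted_sum = Seq (Assign ''acc'' (ConstE 0)) (Seq (Assign ''C'' (Var ''L''))
     (foreach ''c'' ''C''
       (Seq weigh
         (Assign ''acc'' (AddE (Var ''acc'') (MulE (Var ''w'') (TlE (Var ''c''))))))))"

definition enc_entry :: "nat \<Rightarrow> (nat set \<Rightarrow> real) \<Rightarrow> nat set \<Rightarrow> data" where
  "enc_entry d y T = DPair (enc_set d T) (DReal (y T))"

lemma wp_weighted_sum:
  assumes "\<And>T. T \<in> set Ts \<Longrightarrow> T \<subseteq> {1..d}" "distinct Ts" "d \<le> M" "length Ts \<le> M"
    and "s ''L'' = enc_list (map (enc_entry d y) Ts)"
    and "s ''g'' = enc_list (map (\<lambda>i. DReal (b i)) [1..<Suc d])"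
    and "\<And>t s'. t \<le> 10 + M * (40 + M * 20) \<Longrightarrow>
      agree_off {''m'', ''n'', ''w'', ''x'', ''c'', ''C'', ''acc''} s s' \<Longrightarrow>
      s' ''acc'' = DReal (\<Sum>T\<in>set Ts. (\<Prod>i\<in>T. b i) * y T) \<Longrightarrow> Q t s'"
  shows "wp weighted_sum Q s"
  unfolding weighted_sum_def wp_Seq wp_Assign
proof (rule wp_foreach[where f = "enc_entry d y" and xs = Ts and M = M and B = "30 + M * 20"
      and I = "\<lambda>ys zs s'. agree_off {''m'', ''n'', ''w'', ''x'', ''c'', ''C'', ''acc''} s s' \<and>
        s' ''acc'' = DReal (\<Sum>T\<in>set ys. (\<Prod>i\<in>T. b i) * y T)"], goal_cases)
  case (5 ys T zs s')
  then have "T \<notin> set ys" "T \<subseteq> {1..d}" using assms(1,2) by auto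
  then show ?case unfolding wp_Seq wp_Assign
    by (intro wp_weigh[where T = T and d = d and M = M and b = b and r = "DReal (y T)"])
      (use 5 assms(3,6) in \<open>auto simp: agree_off_def enc_entry_def simp del: upt_Suc\<close>)
next
  case (6 t s')
  then show ?case by (intro assms(7)) (auto simp: algebra_simps)
qed (use assms in \<open>auto simp: agree_off_def\<close>)

section \<open>Sign vector of a pair of sets\<close>

definition signs_reversed :: com where
  "signs_reversed = Seq (Assign ''m'' (HdE (Var ''a''))) (Seq (Assign ''n'' (HdE (Var ''b'')))
     (Seq (Assign ''f'' (PairE NilE NilE)) (Seq (Assign ''r'' NilE)
       (foreach ''x'' ''m''
         (Seq
           (Cond (Var ''x'')
             (Cond (HdE (Var ''n''))
               (Assign ''r'' (PairE (ConstE (-1)) (Var ''r'')))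
               (Assign ''r'' (PairE (ConstE 1) (Var ''r''))))
             (Seq (Assign ''r'' (PairE (ConstE 0) (Var ''r'')))
               (Cond (HdE (Var ''n'')) (Assign ''f'' NilE) Skip)))
           (Assign ''n'' (TlE (Var ''n''))))))))"

definition sgn_of :: "nat set \<Rightarrow> nat set \<Rightarrow> nat \<Rightarrow> real" where
  "sgn_of S U i = (if i \<in> S then if i \<in> U then -1 else 1 else 0)"

text \<open>Consing yields the signs from index \<open>d\<close> down to 1. The flag
  \<open>''f''\<close> starts true and is cleared at any index in \<open>U\<close> but not in
  \<open>S\<close>, so the same walk decides \<open>U \<subseteq> S\<close>.\<close>

lemma wp_signs_reversed:
  assumes "U \<subseteq> {1..d}" "d \<le> M"
    and "s ''a'' = enc_entry d y S" "s ''b'' = enc_entry d y U"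
    and "\<And>t s'. t \<le> 20 + M * 40 \<Longrightarrow> agree_off {''m'', ''n'', ''f'', ''r'', ''x''} s s' \<Longrightarrow>
      s' ''f'' = enc_bool (U \<subseteq> S) \<Longrightarrow>
      s' ''r'' = enc_list (map (\<lambda>i. DReal (sgn_of S U i)) (rev [1..<Suc d])) \<Longrightarrow> Q t s'"
  shows "wp signs_reversed Q s"
  unfolding signs_reversed_def wp_Seq wp_Assign
proof (rule wp_foreach[where f = "\<lambda>i. enc_bool (i \<in> S)" and xs = "[1..<Suc d]" and M = M and B = 30
      and I = "\<lambda>ys zs s'. agree_off {''m'', ''n'', ''f'', ''r'', ''x''} s s' \<and>
        s' ''n'' = enc_list (map (\<lambda>i. enc_bool (i \<in> U)) zs) \<and>
        s' ''f'' = enc_bool (U \<inter> set ys \<subseteq> S) \<and>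
        s' ''r'' = enc_list (map (\<lambda>i. DReal (sgn_of S U i)) (rev ys))"], goal_cases)
  case (5 ys x zs s')
  then show ?case
    by (auto simp: agree_off_def sgn_of_def enc_bool_def)
next
  case (6 t s')
  have "U \<inter> set [1..<Suc d] = U" using assms(1) by auto
  then show ?case using 6 by (intro assms(5)) (auto simp del: upt_Suc set_upt)
qed (use assms in \<open>auto simp: agree_off_def enc_set_def enc_entry_def enc_bool_def\<close>)

text \<open>Restores increasing index order, which both \<open>weigh\<close> and
  \<open>enc_signs\<close> expect.\<close>

definition reverse :: com where
  "reverse = Seq (Assign ''g'' NilE)
     (foreach ''x'' ''r'' (Assign ''g'' (PairE (Var ''x'') (Var ''g''))))"

lemma wp_reverse:
  assumes "length xs \<le> M" "s ''r'' = enc_list (map f xs)"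
    and "\<And>t s'. t \<le> 5 + M * 20 \<Longrightarrow> agree_off {''g'', ''r'', ''x''} s s' \<Longrightarrow>
      s' ''g'' = enc_list (map f (rev xs)) \<Longrightarrow> Q t s'"
  shows "wp reverse Q s"
  unfolding reverse_def wp_Seq wp_Assign
  by (rule wp_foreach[where f = f and xs = xs and M = M and B = 12
      and I = "\<lambda>ys zs s'. agree_off {''g'', ''r'', ''x''} s s' \<and>
        s' ''g'' = enc_list (map f (rev ys))"])
    (use assms in \<open>auto simp: agree_off_def\<close>)

section \<open>One row of the output\<close>

definition signs :: "nat set \<Rightarrow> nat set \<Rightarrow> nat \<Rightarrow> int" where
  "signs S U = restrict (\<lambda>i. if i \<in> U then -1 else 1) S"

text \<open>Shaped as the program computes it; \<open>estimate_eq\<close> reduces the sum to the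
  subsets of \<open>S\<close>. Being a sum of exact reals over a set, it does not depend on the
  order \<open>Ts\<close> of the input.\<close>

definition estimate :: "nat \<Rightarrow> nat \<Rightarrow> (nat set \<Rightarrow> real) \<Rightarrow> nat set \<Rightarrow> (nat \<Rightarrow> int) \<Rightarrow> real" where
  "estimate d k y S \<beta> =
     (\<Sum>T\<in>low_sets d k. (\<Prod>i\<in>T. if i \<in> S then real_of_int (\<beta> i) else 0) * y T) / 2 ^ k"

definition enc_marginal :: "nat \<Rightarrow> nat \<Rightarrow> (nat set \<Rightarrow> real) \<Rightarrow> nat set \<Rightarrow> nat set \<Rightarrow> data" where
  "enc_marginal d k y S U = DPair (enc_set d S)
     (DPair (enc_signs d S (signs S U)) (DReal (estimate d k y S (signs S U))))"

definition emit :: com where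
  "emit = Seq signs_reversed (Cond (Var ''f'')
     (Seq reverse (Seq weighted_sum
       (Assign ''out'' (PairE (PairE (HdE (Var ''a''))
         (PairE (Var ''g'') (DivE (Var ''acc'') (Var ''P'')))) (Var ''out'')))))
     Skip)"

text \<open>Every variable that \<open>emit\<close> may write. The table \<open>''L''\<close>, the
  power \<open>''P''\<close>, the rows \<open>''a''\<close>, \<open>''b''\<close> and the loop lists
  \<open>''A''\<close>, \<open>''B''\<close> are outside, so the enclosing loops can rely on
  them.\<close>

definition work_vars :: "vname set" where
  "work_vars = {''m'', ''n'', ''w'', ''x'', ''c'', ''C'', ''acc'', ''f'', ''r'', ''g'', ''out''}"

lemma sgn_of_eq: "sgn_of S U i = (if i \<in> S then real_of_int (signs S U i) else 0)"
  by (simp add: sgn_of_def signs_def)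

lemma wp_emit:
  assumes "set Ts = low_sets d k" "distinct Ts" "d \<le> M" "length Ts \<le> M" "U \<in> set Ts"
    and "s ''L'' = enc_list (map (enc_entry d y) Ts)" "s ''P'' = DReal (2 ^ k)"
    and "s ''a'' = enc_entry d y S" "s ''b'' = enc_entry d y U"
    and "\<And>t s'. t \<le> 60 + M * (100 + M * 20) \<Longrightarrow> agree_off work_vars s s' \<Longrightarrow>
      s' ''out'' = (if U \<subseteq> S then DPair (enc_marginal d k y S U) (s ''out'') else s ''out'') \<Longrightarrow> Q t s'"
  shows "wp emit Q s"
  unfolding emit_def wp_Seq wp_Cond
proof (rule wp_signs_reversed[where d = d and y = y and S = S and U = U and M = M], goal_cases)
  case (5 t1 s1)
  show ?case
  proof (cases "U \<subseteq> S")
    case False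
    have "Q (t1 + 3) s1"
      by (rule assms(10)) (use False 5(1,2) in \<open>simp_all add: agree_off_def work_vars_def algebra_simps\<close>)
    then show ?thesis using 5(3) False by (simp add: eval_nat_numeral)
  next
    case True
    \<comment> \<open>Cost 2 is the test of \<open>''f''\<close> and 11 the final assignment, whose
      effect is spelled out in the state.\<close>
    have "wp reverse (\<lambda>t2. wp weighted_sum (\<lambda>t3 s3. Q (t1 + (1 + 1 + (t2 + (t3 + 11))))
        (s3(''out'' := DPair (DPair (fst_of (s3 ''a''))
          (DPair (s3 ''g'') (arith (/) (s3 ''acc'') (s3 ''P'')))) (s3 ''out''))))) s1"
    proof (rule wp_reverse[where M = M and f = "\<lambda>i. DReal (sgn_of S U i)" and xs = "rev [1..<Suc d]"],
        goal_cases)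
      case (3 t2 s2)
      show ?case
      proof (rule wp_weighted_sum[where Ts = Ts and d = d and M = M and y = y and b = "sgn_of S U"],
          goal_cases)
        case (7 t3 s3)
        have frame: "agree_off work_vars s s3"
          using 5(2) 3(2) 7(2) by (auto simp: agree_off_def work_vars_def)
        have vars: "s3 ''a'' = enc_entry d y S" "s3 ''P'' = DReal (2 ^ k)" "s3 ''out'' = s ''out''"
          "s3 ''g'' = enc_signs d S (signs S U)"
          using 5(2) 3(2,3) 7(2) assms(7,8)
          by (simp_all add: agree_off_def enc_signs_def sgn_of_eq del: upt_Suc)
        have "(\<Sum>T\<in>set Ts. prod (sgn_of S U) T * y T) / 2 ^ k = estimate d k y S (signs S U)"
          by (simp add: estimate_def assms(1) flip: sgn_of_eq)
        then show ?case
          using frame 5(1) 3(1) 7(1,3) True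
          by (intro assms(10))
            (auto simp: vars agree_off_def work_vars_def enc_marginal_def enc_entry_def algebra_simps)
      qed (use 3 5(2) assms(1-4,6) in \<open>auto simp: agree_off_def low_sets_def simp del: upt_Suc\<close>)
    qed (use 5(4) assms(3) in \<open>auto simp del: upt_Suc\<close>)
    then show ?thesis using 5(3) True by (simp add: eval_nat_numeral)
  qed
qed (use assms(1-9) in \<open>auto simp: low_sets_def\<close>)

section \<open>Loops over pairs of sets\<close>

definition card_power :: com where
  "card_power = Seq (Assign ''m'' (HdE (Var ''a''))) (Seq (Assign ''Q'' (ConstE 1))
     (foreach ''x'' ''m'' (Cond (Var ''x'') (Assign ''Q'' (AddE (Var ''Q'') (Var ''Q''))) Skip)))"

text \<open>A power of 2 is kept instead of a count because it can be compared with
  \<open>''P''\<close>, which \<open>emit\<close> uses as divisor.\<close>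

lemma wp_card_power:
  assumes "S \<subseteq> {1..d}" "d \<le> M" and "s ''a'' = enc_entry d y S"
    and "\<And>t s'. t \<le> 10 + M * 20 \<Longrightarrow> agree_off {''m'', ''Q'', ''x''} s s' \<Longrightarrow>
      s' ''Q'' = DReal (2 ^ card S) \<Longrightarrow> Q t s'"
  shows "wp card_power Q s"
  unfolding card_power_def wp_Seq wp_Assign
proof (rule wp_foreach[where f = "\<lambda>i. enc_bool (i \<in> S)" and xs = "[1..<Suc d]" and M = M and B = 12
      and I = "\<lambda>ys zs s'. agree_off {''m'', ''Q'', ''x''} s s' \<and>
        s' ''Q'' = DReal (2 ^ card (S \<inter> set ys))"], goal_cases)
  case (5 ys x zs s')
  have "distinct (ys @ x # zs)" unfolding 5(1)[symmetric] by simp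
  then show ?case using 5
    by (auto simp: agree_off_def)
next
  case (6 t s')
  have "S \<inter> set [1..<Suc d] = S" using assms(1) by auto
  then show ?case using 6 by (intro assms(4)) auto
qed (use assms in \<open>auto simp: agree_off_def enc_set_def enc_entry_def\<close>)

text \<open>All listed sets have at most \<open>k\<close> elements, so \<open>\<not> 2 ^ card S < 2 ^ k\<close> tests
  \<open>card S = k\<close>.\<close>

definition block :: com where
  "block = Seq card_power (Cond (LessE (Var ''Q'') (Var ''P'')) Skip
     (Seq (Assign ''B'' (Var ''L'')) (foreach ''b'' ''B'' emit)))"

text \<open>The reversal reflects that results are consed onto \<open>''out''\<close>.\<close>

definition pairs :: "nat \<Rightarrow> (nat set \<times> nat set) list \<Rightarrow> (nat set \<times> nat set) list" where
  "pairs k ps = rev (filter (\<lambda>(S, U). card S = k \<and> U \<subseteq> S) ps)"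

text \<open>\<open>ps\<close> lists the pairs already visited; one block visits \<open>S\<close>
  paired with each row of the table. Any \<open>ps\<close> is allowed so that the outer loop can
  chain blocks.\<close>

lemma wp_block:
  assumes "set Ts = low_sets d k" "distinct Ts" "d \<le> M" "length Ts \<le> M" "S \<in> set Ts"
    and "s ''L'' = enc_list (map (enc_entry d y) Ts)" "s ''P'' = DReal (2 ^ k)"
    and "s ''a'' = enc_entry d y S"
    and "s ''out'' = enc_list (map (case_prod (enc_marginal d k y)) (pairs k ps))"
    and "\<And>t s'. t \<le> 30 + M * (90 + M * (100 + M * 20)) \<Longrightarrow>
      agree_off (insert ''Q'' (insert ''b'' (insert ''B'' work_vars))) s s' \<Longrightarrow>
      s' ''out'' = enc_list (map (case_prod (enc_marginal d k y)) (pairs k (ps @ map (Pair S) Ts)))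
      \<Longrightarrow> Q t s'"
  shows "wp block Q s"
proof -
  let ?V = "insert ''Q'' (insert ''b'' (insert ''B'' work_vars))"
  let ?out = "\<lambda>ps. enc_list (map (case_prod (enc_marginal d k y)) (pairs k ps))"
  have S: "S \<subseteq> {1..d}" "card S \<le> k" using assms(1,5) by (auto simp: low_sets_def)
  show ?thesis
    unfolding block_def wp_Seq wp_Cond
  proof (rule wp_card_power[where s = s and y = y, OF S(1) assms(3,8)], goal_cases)
    case (1 t1 s1)
    have agree: "agree_off ?V s s1" and P: "s1 ''P'' = DReal (2 ^ k)"
      and out: "s1 ''out'' = ?out ps"
      using 1(2) assms(7,9) by (auto simp: agree_off_def work_vars_def)
    show ?case
    proof (cases "card S = k")
      case False
      then have "pairs k (ps @ map (Pair S) Ts) = pairs k ps"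
        by (auto simp: pairs_def filter_empty_conv)
      then have "Q (t1 + 5) s1"
        by (intro assms(10)) (use agree out 1(1) in \<open>simp_all add: algebra_simps\<close>)
      moreover have "card S < k" using S(2) False by simp
      ultimately show ?thesis using 1(3) P by (simp add: enc_bool_def eval_nat_numeral)
    next
      case True
      have "wp (foreach ''b'' ''B'' emit) (\<lambda>t2. Q (t1 + (1 + 3 + (2 + t2)))) (s1(''B'' := s1 ''L''))"
      proof (rule wp_foreach[where f = "enc_entry d y" and xs = Ts and M = M
            and B = "60 + M * (100 + M * 20)"
            and I = "\<lambda>ys zs s'. agree_off ?V s s' \<and> s' ''out'' = ?out (ps @ map (Pair S) ys)"],
          goal_cases)
        case (5 ys U zs s2)
        let ?s2 = "s2(''b'' := enc_entry d y U, ''B'' := enc_list (map (enc_entry d y) zs))"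
        have U: "U \<in> set Ts" using 5(1) by simp
        have vars: "?s2 ''L'' = enc_list (map (enc_entry d y) Ts)" "?s2 ''P'' = DReal (2 ^ k)"
          "?s2 ''a'' = enc_entry d y S" "?s2 ''b'' = enc_entry d y U"
          using 5(2) assms(6-8) by (simp_all add: agree_off_def work_vars_def)
        show ?case
        proof (rule wp_emit[where s = ?s2, OF assms(1-4) U vars], goal_cases)
          case (1 t3 s3)
          have "s3 ''out'' = ?out (ps @ map (Pair S) (ys @ [U]))"
            using 1(3) 5(2) True by (simp add: pairs_def)
          moreover have "agree_off ?V s s3" "s3 ''B'' = enc_list (map (enc_entry d y) zs)"
            using 1(2) 5(2) by (auto simp: agree_off_def work_vars_def)
          ultimately show ?case using 1(1) by simp
        qed
      next
        case (6 t2 s2)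
        then show ?case
          by (intro assms(10)) (use 1(1) in \<open>simp_all add: algebra_simps\<close>)
      qed (use agree out 1(2) assms(4,6) in \<open>simp_all add: agree_off_def work_vars_def\<close>)
      then show ?thesis using 1(3) P True by (simp add: enc_bool_def eval_nat_numeral)
    qed
  qed
qed

text \<open>\<open>k\<close> is given in unary, so one doubling per cell makes \<open>''P''\<close>
  equal to \<open>2 ^ k\<close>. The lists \<open>''A''\<close>, \<open>''B''\<close>,
  \<open>''C''\<close> are copies of \<open>''L''\<close> that the three nested loops
  consume.\<close>

definition marginals_program :: com where
  "marginals_program = Seq (Assign ''m'' (HdE (TlE (Var ''in'')))) (Seq (Assign ''P'' (ConstE 1))
     (Seq (foreach ''x'' ''m'' (Assign ''P'' (AddE (Var ''P'') (Var ''P''))))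
       (Seq (Assign ''L'' (TlE (TlE (Var ''in'')))) (Seq (Assign ''A'' (Var ''L''))
         (foreach ''a'' ''A'' block)))))"

text \<open>One more set in the outer loop appends one block of pairs, the form in which
  \<open>wp_block\<close> extends \<open>ps\<close>.\<close>

lemma product_snoc: "List.product (xs @ [x]) ys = List.product xs ys @ map (Pair x) ys"
  by (induction xs) auto

text \<open>Three nested passes over the table with a walk along a vector inside give degree 4. The
  outer loop costs at most \<open>2 + M * (38 + 90 * M + 100 * M ^ 2 + 20 * M ^ 3)\<close>; the
  slack in the two lowest coefficients covers the setup.\<close>

lemma wp_marginals_program:
  assumes "set Ts = low_sets d k" "distinct Ts" "d \<le> M" "k \<le> M" "length Ts \<le> M"
    and "s ''in'' = enc_estimates d k y Ts" "s ''out'' = DNil"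
  shows "wp marginals_program
    (\<lambda>t s'. t \<le> poly [:50, 100, 90, 100, 20:] M \<and>
      s' ''out'' = enc_list (map (case_prod (enc_marginal d k y)) (pairs k (List.product Ts Ts)))) s"
  unfolding marginals_program_def wp_Seq wp_Assign
proof (rule wp_foreach[where f = "\<lambda>x. x" and xs = "replicate k DNil" and M = M and B = 8
      and I = "\<lambda>ys zs s'. agree_off {''m'', ''P'', ''x''} s s' \<and> s' ''P'' = DReal (2 ^ length ys)"],
    goal_cases)
  case (6 t1 s1)
  let ?V = "insert ''P'' (insert ''L'' (insert ''A'' (insert ''a''
    (insert ''Q'' (insert ''b'' (insert ''B'' work_vars))))))"
  let ?out = "\<lambda>ys. enc_list (map (case_prod (enc_marginal d k y)) (pairs k (List.product ys Ts)))"
  have s1: "s1 ''P'' = DReal (2 ^ k)" "s1 ''out'' = DNil" "s1 ''in'' = enc_estimates d k y Ts"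
    using 6(2) assms(6,7) by (simp_all add: agree_off_def)
  show ?case
  proof (rule wp_foreach[where f = "enc_entry d y" and xs = Ts and M = M
        and B = "30 + M * (90 + M * (100 + M * 20))"
        and I = "\<lambda>ys zs s'. s' ''L'' = enc_list (map (enc_entry d y) Ts) \<and>
          s' ''P'' = DReal (2 ^ k) \<and> s' ''out'' = ?out ys"], goal_cases)
    case (5 ys S zs s2)
    let ?s2 = "s2(''a'' := enc_entry d y S, ''A'' := enc_list (map (enc_entry d y) zs))"
    have S: "S \<in> set Ts" using 5(1) by simp
    have vars: "?s2 ''L'' = enc_list (map (enc_entry d y) Ts)" "?s2 ''P'' = DReal (2 ^ k)"
      "?s2 ''a'' = enc_entry d y S" "?s2 ''out'' = ?out ys"
      using 5(2) by simp_all
    show ?case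
    proof (rule wp_block[where s = ?s2, OF assms(1-3,5) S vars], goal_cases)
      case (1 t3 s3)
      then show ?case using vars
        by (simp add: agree_off_def work_vars_def product_snoc)
    qed
  next
    case (6 t2 s2)
    then show ?case using \<open>t1 \<le> _\<close> by (simp add: algebra_simps)
  qed (use s1 assms(5) in \<open>simp_all add: enc_estimates_def enc_entry_def[abs_def] pairs_def\<close>)
qed (use assms in \<open>auto simp: agree_off_def enc_estimates_def enc_nat_def\<close>)

section \<open>Sign patterns as subsets\<close>

lemma signs_mem: "signs S U \<in> S \<rightarrow>\<^sub>E {-1, 1}"
  by (auto simp: signs_def)

lemma negative_set_signs: "U \<subseteq> S \<Longrightarrow> {i \<in> S. signs S U i = -1} = U"
  by (auto simp: signs_def)

text \<open>Outside \<open>S\<close> both sides are \<open>undefined\<close>, thanks to the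
  \<open>restrict\<close> in \<open>signs\<close>.\<close>

lemma signs_negative_set: "\<beta> \<in> S \<rightarrow>\<^sub>E {-1, 1} \<Longrightarrow> signs S {i \<in> S. \<beta> i = -1} = \<beta>"
  by (auto simp: signs_def fun_eq_iff PiE_def extensional_def Pi_def)

text \<open>The inverse sends a pattern to the set where it is -1. Hence listing the pairs
  \<open>(S, U)\<close> lists every query exactly once.\<close>

lemma bij_betw_signs:
  "bij_betw (\<lambda>(S, U). (S, signs S U)) {(S, U). S \<subseteq> {1..d} \<and> card S = k \<and> U \<subseteq> S} (marg_queries d k)"
  by (rule bij_betwI[where g = "\<lambda>(S, \<beta>). (S, {i \<in> S. \<beta> i = -1})"])
    (auto simp: marg_queries_def signs_mem negative_set_signs signs_negative_set,
      auto simp: signs_def split: if_splits)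

text \<open>A subset \<open>U\<close> of a set with \<open>k\<close> elements is itself in
  \<open>low_sets d k\<close>, so ranging over the table misses no \<open>U\<close>.\<close>

lemma set_pairs:
  assumes "set Ts = low_sets d k"
  shows "set (pairs k (List.product Ts Ts)) = {(S, U). S \<subseteq> {1..d} \<and> card S = k \<and> U \<subseteq> S}"
proof -
  have "card U \<le> card S" "U \<subseteq> {1..d}" if "S \<subseteq> {1..d}" "U \<subseteq> S" for S U :: "nat set"
    using that by (auto intro: card_mono finite_subset)
  then show ?thesis by (auto simp: pairs_def assms low_sets_def)
qed

section \<open>Correctness and running time in terms of the input size\<close>

lemma length_le_dsize_enc_list: "length xs \<le> dsize (enc_list xs)"
  by (induction xs) auto

lemma constructs_within_marginals_program:
  "constructs_within marginals_program [:50, 100, 90, 100, 20:] d k y (estimate d k y)"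
  unfolding constructs_within_def
proof (intro allI impI)
  fix Ts assume Ts: "distinct Ts \<and> set Ts = low_sets d k"
  let ?ps = "pairs k (List.product Ts Ts)"
  let ?Qs = "map (\<lambda>(S, U). (S, signs S U)) ?ps"
  let ?in = "enc_estimates d k y Ts"
  \<comment> \<open>\<open>d\<close> and \<open>k\<close> are in unary and each table row takes a
    cell, so \<open>M\<close> can be the input size.\<close>
  have "d \<le> dsize ?in" "k \<le> dsize ?in" "length Ts \<le> dsize ?in"
    using length_le_dsize_enc_list[of "replicate d DNil"]
      length_le_dsize_enc_list[of "replicate k DNil"]
      length_le_dsize_enc_list[of "map (\<lambda>T. DPair (enc_set d T) (DReal (y T))) Ts"]
    by (simp_all add: enc_estimates_def enc_nat_def)
  with Ts have "wp marginals_program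
    (\<lambda>t s'. t \<le> poly [:50, 100, 90, 100, 20:] (dsize ?in) \<and>
      s' ''out'' = enc_list (map (case_prod (enc_marginal d k y)) ?ps))
    ((\<lambda>_. DNil)(''in'' := ?in))"
    by (intro wp_marginals_program) auto
  then obtain t s where "exec marginals_program ((\<lambda>_. DNil)(''in'' := ?in)) t s"
    and t: "t \<le> poly [:50, 100, 90, 100, 20:] (dsize ?in)"
    and "s ''out'' = enc_list (map (case_prod (enc_marginal d k y)) ?ps)"
    unfolding wp_def by blast
  moreover have "enc_list (map (case_prod (enc_marginal d k y)) ?ps)
      = enc_marginals d (estimate d k y) ?Qs"
    unfolding enc_marginals_def map_map
    by (intro arg_cong[where f = enc_list] map_cong) (auto simp: enc_marginal_def)
  ultimately have "computes_in marginals_program ?in t (enc_marginals d (estimate d k y) ?Qs)"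
    unfolding computes_in_def by auto
  moreover have "distinct ?ps" using Ts by (simp add: pairs_def distinct_product)
  then have "distinct ?Qs" "set ?Qs = marg_queries d k"
    using bij_betw_signs[of d k] Ts
    by (simp_all add: distinct_map set_pairs bij_betw_def)
  ultimately show "\<exists>t Qs. distinct Qs \<and> set Qs = marg_queries d k \<and>
      t \<le> poly [:50, 100, 90, 100, 20:] (dsize ?in) \<and>
      computes_in marginals_program ?in t (enc_marginals d (estimate d k y) Qs)"
    using t by (intro exI conjI)
qed

section \<open>Accuracy of the estimates\<close>

lemma marg_eq_parity_sum:
  assumes "database d D" "S \<subseteq> {1..d}" "\<beta> \<in> S \<rightarrow>\<^sub>E {-1, 1}"
  shows "2 ^ card S * marg S \<beta> D = (\<Sum>T\<in>Pow S. (\<Prod>i\<in>T. \<beta> i) * parity T D)"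
proof -
  have fin: "finite S" using assms(2) finite_subset by blast
  have "2 ^ card S * (\<Prod>i\<in>S. of_bool (e i = \<beta> i)) = (\<Sum>T\<in>Pow S. (\<Prod>i\<in>T. \<beta> i) * (\<Prod>i\<in>T. e i))"
    if "e \<in># D" for e
  proof -
    \<comment> \<open>Multiplying by 2 keeps the indicator identity inside the integers.\<close>
    have "2 * of_bool (e i = \<beta> i) = \<beta> i * e i + 1" if "i \<in> S" for i
    proof -
      have "e i \<in> {-1, 1}" "\<beta> i \<in> {-1, 1}"
        using assms \<open>e \<in># D\<close> that unfolding database_def by (blast dest: PiE_mem)+
      then show ?thesis by auto
    qed
    then have "(\<Prod>i\<in>S. 2 * of_bool (e i = \<beta> i)) = (\<Prod>i\<in>S. \<beta> i * e i + 1)"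
      by (intro prod.cong) auto
    then show ?thesis
      \<comment> \<open>\<open>prod_add\<close> expands the product over the sets \<open>T\<close>
        of indices at which \<open>\<beta> i * e i\<close> is chosen.\<close>
      using fin by (simp add: prod.distrib prod_add)
  qed
  then have "2 ^ card S * marg S \<beta> D
      = (\<Sum>e\<in>#D. \<Sum>T\<in>Pow S. (\<Prod>i\<in>T. \<beta> i) * (\<Prod>i\<in>T. e i))"
    unfolding marg_def sum_mset_distrib_left by (intro arg_cong[where f = sum_mset] image_mset_cong)
  \<comment> \<open>Exchanges the two sums, by induction on the multiset \<open>D\<close>.\<close>
  also have "\<dots> = (\<Sum>T\<in>Pow S. (\<Prod>i\<in>T. \<beta> i) * parity T D)"
    unfolding parity_def sum_mset_distrib_left by (induction D) (simp_all add: sum.distrib)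
  finally show ?thesis .
qed

text \<open>A set in \<open>low_sets d k\<close> not contained in \<open>S\<close> has an element
  where the padded factor is 0; conversely every subset of \<open>S\<close> has at most
  \<open>k\<close> elements.\<close>

lemma estimate_eq:
  assumes "S \<subseteq> {1..d}" "card S = k"
  shows "estimate d k y S \<beta> = (\<Sum>T\<in>Pow S. (\<Prod>i\<in>T. real_of_int (\<beta> i)) * y T) / 2 ^ k"
proof -
  have fin: "finite S" using assms(1) finite_subset by blast
  have "(\<Sum>T\<in>low_sets d k. (\<Prod>i\<in>T. if i \<in> S then real_of_int (\<beta> i) else 0) * y T)
      = (\<Sum>T\<in>Pow S. (\<Prod>i\<in>T. if i \<in> S then real_of_int (\<beta> i) else 0) * y T)"
  proof (rule sum.mono_neutral_right)
    show "finite (low_sets d k)"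
      by (rule finite_subset[of _ "Pow {1..d}"]) (auto simp: low_sets_def)
    show "Pow S \<subseteq> low_sets d k"
      using assms fin by (auto simp: low_sets_def intro: card_mono)
    show "\<forall>T\<in>low_sets d k - Pow S.
        (\<Prod>i\<in>T. if i \<in> S then real_of_int (\<beta> i) else 0) * y T = 0"
      \<comment> \<open>\<open>T\<close> must be finite: over an infinite set the product would be
        1.\<close>
      using finite_subset[OF _ finite_atLeastAtMost] by (auto simp: low_sets_def intro!: prod_zero)
  qed
  also have "\<dots> = (\<Sum>T\<in>Pow S. (\<Prod>i\<in>T. real_of_int (\<beta> i)) * y T)"
    by (intro sum.cong arg_cong2[where f = "(*)"] prod.cong) auto
  finally show ?thesis by (simp add: estimate_def)
qed

text \<open>The \<open>2 ^ k\<close> terms have coefficients of absolute value 1, so the scaled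
  error is at most \<open>2 ^ k * lam\<close>, and the factor cancels.\<close>

lemma estimate_error:
  assumes "database d D" "S \<subseteq> {1..d}" "card S = k" "\<beta> \<in> S \<rightarrow>\<^sub>E {-1, 1}"
    and y: "\<And>T. T \<subseteq> {1..d} \<Longrightarrow> card T \<le> k \<Longrightarrow> \<bar>y T - real_of_int (parity T D)\<bar> \<le> lam"
  shows "\<bar>estimate d k y S \<beta> - real_of_int (marg S \<beta> D)\<bar> \<le> lam"
proof -
  have fin: "finite S" using assms(2) finite_subset by blast
  have "2 ^ k * real_of_int (marg S \<beta> D)
      = (\<Sum>T\<in>Pow S. (\<Prod>i\<in>T. real_of_int (\<beta> i)) * real_of_int (parity T D))"
    using arg_cong[OF marg_eq_parity_sum[OF assms(1,2,4)], of real_of_int] assms(3) by simp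
  then have "2 ^ k * (estimate d k y S \<beta> - real_of_int (marg S \<beta> D))
      = (\<Sum>T\<in>Pow S. (\<Prod>i\<in>T. real_of_int (\<beta> i)) * (y T - real_of_int (parity T D)))"
    by (simp add: estimate_eq[OF assms(2,3)] right_diff_distrib sum_subtractf)
  moreover have "\<bar>(\<Prod>i\<in>T. real_of_int (\<beta> i)) * (y T - real_of_int (parity T D))\<bar> \<le> lam"
    if "T \<in> Pow S" for T
  proof -
    have "\<bar>real_of_int (\<beta> i)\<bar> = 1" if "i \<in> T" for i
      using assms(4) that \<open>T \<in> Pow S\<close> by (auto simp: PiE_def Pi_def)
    then have "\<bar>\<Prod>i\<in>T. real_of_int (\<beta> i)\<bar> = 1" by (simp add: abs_prod)
    moreover have "T \<subseteq> {1..d}" "card T \<le> k"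
      using that assms(2,3) fin by (auto intro: card_mono)
    ultimately show ?thesis using y[of T] by (simp add: abs_mult)
  qed
  then have "\<bar>\<Sum>T\<in>Pow S. (\<Prod>i\<in>T. real_of_int (\<beta> i)) * (y T - real_of_int (parity T D))\<bar>
      \<le> of_nat (card (Pow S)) * lam"
    by (intro order_trans[OF sum_abs] sum_bounded_above)
  moreover have "of_nat (card (Pow S)) = (2 ^ k :: real)"
    using fin assms(3) by (simp add: card_Pow)
  ultimately have "2 ^ k * \<bar>estimate d k y S \<beta> - real_of_int (marg S \<beta> D)\<bar> \<le> 2 ^ k * lam"
    by (metis abs_mult abs_of_nonneg zero_le_numeral zero_le_power)
  then show ?thesis by simp
qed

theorem theorem7:
  "\<exists>(c :: com) (p :: nat poly). \<forall>(d :: nat) (k :: nat) (y :: nat set \<Rightarrow> real).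
     \<exists>z :: nat set \<Rightarrow> (nat \<Rightarrow> int) \<Rightarrow> real.
       constructs_within c p d k y z \<and>
       (\<forall>(D :: (nat \<Rightarrow> int) multiset) (lam :: real).
          database d D \<and> lam \<ge> 0 \<and>
          (\<forall>T. T \<subseteq> {1..d} \<and> card T \<le> k \<longrightarrow> \<bar>y T - real_of_int (parity T D)\<bar> \<le> lam) \<longrightarrow>
          (\<forall>S \<beta>. S \<subseteq> {1..d} \<and> card S = k \<and> \<beta> \<in> S \<rightarrow>\<^sub>E {-1, 1} \<longrightarrow>
             \<bar>z S \<beta> - real_of_int (marg S \<beta> D)\<bar> \<le> lam))"
proof (intro exI allI conjI impI)
  show "constructs_within marginals_program [:50, 100, 90, 100, 20:] d k y (estimate d k y)"
    for d k y by (rule constructs_within_marginals_program)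
qed (elim conjE, rule estimate_error, auto)

end
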